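(* Let $T=(T^{*},T^{\triangle})$ be a spherical latin bitrade. Then $T( * )$ can be embedded into the abelian group $\mathbf{H}(T)$, and $\mathbf{H}(T)$ is finite.
   Context: A latin bitrade is a pair $T=(T^{*},T^{\triangle})$ of finite sets of triples satisfying: (R1) $T^{*}\cap T^{\triangle}=\emptyset$; (R2) for every $p\in T^{*}$ and all $r\neq s$ in $\{1,2,3\}$ there is exactly one $q\in T^{\triangle}$ with $p_r=q_r$, $p_s=q_s$; (R3) for every $q\in T^{\triangle}$ and all $r\neq s$ there is exactly one $p\in T^{*}$ with $q_r=p_r$, $q_s=p_s$. First, second, third coordinates (rows, columns, symbols) use pairwise disjoint label sets. $T$ is indecomposable if it is not the disjoint union of two nonempty latin bitrades. With $s=|T^{*}|$, $o_i$ the number of distinct $i$-th coordinates in $T^{*}$ and $m=o_1+o_2+o_3$, $T$ is spherical if it is indecomposable and $m=s+2$. $T( * )$ is the partial operation with $u_1*u_2=u_3$ iff $(u_1,u_2,u_3)\in T^{*}$. A homotopy of $T( * )$ into an abelian group $G(+)$ is a triple $(\sigma_1,\sigma_2,\sigma_3)$, $\sigma_i$ defined on the set of $i$-th coordinates of elements of $T^{*}$, with $\sigma_1(u_1)+\sigma_2(u_2)=\sigma_3(u_3)$ for all $(u_1,u_2,u_3)\in T^{*}$; it is an embedding if all $\sigma_i$ are injective. Let $F(T)$ be the free abelian group generated by all labels, $N(T)$ the subgroup generated by all $a_1+a_2-a_3$ with $(a_1,a_2,a_3)\in T^{*}$, $\mathbf{G}(T)=F(T)/N(T)$, and $g_i(x)=x+N(T)$.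 $\mathbf{H}(T)$ is the subgroup of $\mathbf{G}(T)$ generated by all $g_i(b_i)-g_i(d_i)$ with $(b_1,b_2,b_3),(d_1,d_2,d_3)\in T^{*}$ and $i\in\{1,2,3\}$. *)

theory Defs
  imports "HOL-Algebra.Free_Abelian_Groups"
begin

type_synonym 'a triple = "'a \<times> 'a \<times> 'a"

(* Coordinates are indexed by 1, 2, 3 and only ever used at these values. *)
definition coord :: "nat \<Rightarrow> 'a triple \<Rightarrow> 'a" where
  "coord i p = (if i = 1 then fst p else if i = 2 then fst (snd p) else snd (snd p))"

definition latin_bitrade :: "'a triple set \<times> 'a triple set \<Rightarrow> bool" where
  "latin_bitrade T \<longleftrightarrow>
     finite (fst T) \<and> finite (snd T) \<and>
     (\<forall>r\<in>{1,2,3}. \<forall>s\<in>{1,2,3}. r \<noteq> s \<longrightarrow>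
        coord r ` (fst T \<union> snd T) \<inter> coord s ` (fst T \<union> snd T) = {}) \<and>
     fst T \<inter> snd T = {} \<and>
     (\<forall>p\<in>fst T. \<forall>r\<in>{1,2,3}. \<forall>s\<in>{1,2,3}. r \<noteq> s \<longrightarrow>
        (\<exists>!q. q \<in> snd T \<and> coord r p = coord r q \<and> coord s p = coord s q)) \<and>
     (\<forall>q\<in>snd T. \<forall>r\<in>{1,2,3}. \<forall>s\<in>{1,2,3}. r \<noteq> s \<longrightarrow>
        (\<exists>!p. p \<in> fst T \<and> coord r q = coord r p \<and> coord s q = coord s p))"

definition indecomposable :: "'a triple set \<times> 'a triple set \<Rightarrow> bool" where
  "indecomposable T \<longleftrightarrow>
     \<not> (\<exists>U V. latin_bitrade U \<and> latin_bitrade V \<and> U \<noteq> ({}, {}) \<and> V \<noteq> ({}, {}) \<and>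
          fst U \<inter> fst V = {} \<and> snd U \<inter> snd V = {} \<and>
          fst T = fst U \<union> fst V \<and> snd T = snd U \<union> snd V)"

definition spherical :: "'a triple set \<times> 'a triple set \<Rightarrow> bool" where
  "spherical T \<longleftrightarrow> indecomposable T \<and>
     (\<Sum>i\<in>{1,2,3}. card (coord i ` fst T)) = card (fst T) + 2"

(* The partial operation is represented by its graph P, a set of triples;
   the abelian group G is written multiplicatively. *)
definition homotopy ::
    "'a triple set \<Rightarrow> ('g, 'm) monoid_scheme \<Rightarrow> (nat \<Rightarrow> 'a \<Rightarrow> 'g) \<Rightarrow> bool" where
  "homotopy P G \<sigma> \<longleftrightarrow>
     comm_group G \<and>
     (\<forall>i\<in>{1,2,3}. \<sigma> i \<in> coord i ` P \<rightarrow> carrier G) \<and>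
     (\<forall>(u1, u2, u3)\<in>P. \<sigma> 1 u1 \<otimes>\<^bsub>G\<^esub> \<sigma> 2 u2 = \<sigma> 3 u3)"

definition embedding ::
    "'a triple set \<Rightarrow> ('g, 'm) monoid_scheme \<Rightarrow> (nat \<Rightarrow> 'a \<Rightarrow> 'g) \<Rightarrow> bool" where
  "embedding P G \<sigma> \<longleftrightarrow>
     homotopy P G \<sigma> \<and> (\<forall>i\<in>{1,2,3}. inj_on (\<sigma> i) (coord i ` P))"

definition F_group :: "'a triple set \<times> 'a triple set \<Rightarrow> ('a \<Rightarrow>\<^sub>0 int) monoid" where
  "F_group T = free_Abelian_group (\<Union>i\<in>{1,2,3}. coord i ` (fst T \<union> snd T))"

definition N_subgroup :: "'a triple set \<times> 'a triple set \<Rightarrow> ('a \<Rightarrow>\<^sub>0 int) set" where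
  "N_subgroup T = generate (F_group T)
     {frag_of a1 + frag_of a2 - frag_of a3 | a1 a2 a3. (a1, a2, a3) \<in> fst T}"

definition G_group :: "'a triple set \<times> 'a triple set \<Rightarrow> ('a \<Rightarrow>\<^sub>0 int) set monoid" where
  "G_group T = F_group T Mod N_subgroup T"

(* One map serves for g_1, g_2, g_3, since the three label sets are disjoint subsets of one type. *)
definition g_map :: "'a triple set \<times> 'a triple set \<Rightarrow> 'a \<Rightarrow> ('a \<Rightarrow>\<^sub>0 int) set" where
  "g_map T x = N_subgroup T #>\<^bsub>F_group T\<^esub> frag_of x"

definition H_group :: "'a triple set \<times> 'a triple set \<Rightarrow> ('a \<Rightarrow>\<^sub>0 int) set monoid" where
  "H_group T = subgroup_generated (G_group T)
     {g_map T (coord i b) \<otimes>\<^bsub>G_group T\<^esub> inv\<^bsub>G_group T\<^esub> (g_map T (coord i d)) | i b d.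
        i \<in> {1,2,3} \<and> b \<in> fst T \<and> d \<in> fst T}"

end

theory Submission
  imports Defs
begin

text \<open>
  Write a rational weight on the labels as X, with the sign flipped on symbols, so that a triple
  p of T* imposes the equation X(p_1) + X(p_2) + X(p_3) = 0. Any two coordinates match T* and the
  second mate bijectively, hence the incidence matrices W and B of the two mates satisfy
  W'W = B'B (prime for transpose). So W X = 0 forces B X = 0, and by indecomposability X is then constant
  on rows, on columns and on symbols. Thus W has corank two, and m = s + 2 makes it surjective:
  for every w in T* there is X_w with W X_w equal to the unit vector at w.

  A maximum principle shows that X_w is maximal, among all labels of the same kind, at the labels
  of w, and that it exceeds this maximum minus one everywhere. If u - v lay in N(T), for distinct
  labels u, v of the same kind, then all X_w(u) - X_w(v) would be integers, hence 0 for
  every w containing u. But these numbers, summed over the w containing u, give the coefficient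
  of u in u - v, which is 1.

  The functionals X_w also embed H(T) into a power of Q/Z with bounded denominators, so it is finite.
\<close>

section \<open>Latin bitrades and weights on labels\<close>

lemma latin_bitrade_finite:
  assumes "latin_bitrade T"
  shows "finite (fst T)" "finite (snd T)"
  using assms by (simp_all only: latin_bitrade_def)

lemma latin_bitrade_black_mate:
  assumes T: "latin_bitrade T" and p: "p \<in> fst T" and rs: "r \<in> {1,2,3}" "s \<in> {1,2,3}" "r \<noteq> s"
  shows "\<exists>!q. q \<in> snd T \<and> coord r p = coord r q \<and> coord s p = coord s q"
proof -
  have "\<forall>p\<in>fst T. \<forall>r\<in>{1,2,3}. \<forall>s\<in>{1,2,3}. r \<noteq> s \<longrightarrow>
        (\<exists>!q. q \<in> snd T \<and> coord r p = coord r q \<and> coord s p = coord s q)"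
    using T unfolding latin_bitrade_def by (elim conjE)
  from this[rule_format, OF p rs] show ?thesis .
qed

lemma latin_bitrade_white_mate:
  assumes T: "latin_bitrade T" and q: "q \<in> snd T" and rs: "r \<in> {1,2,3}" "s \<in> {1,2,3}" "r \<noteq> s"
  shows "\<exists>!p. p \<in> fst T \<and> coord r q = coord r p \<and> coord s q = coord s p"
proof -
  have "\<forall>q\<in>snd T. \<forall>r\<in>{1,2,3}. \<forall>s\<in>{1,2,3}. r \<noteq> s \<longrightarrow>
        (\<exists>!p. p \<in> fst T \<and> coord r q = coord r p \<and> coord s q = coord s p)"
    using T unfolding latin_bitrade_def by (elim conjE)
  from this[rule_format, OF q rs] show ?thesis .
qed

lemma latin_bitrade_labels_disjoint:
  assumes T: "latin_bitrade T" and rs: "r \<in> {1,2,3}" "s \<in> {1,2,3}" "r \<noteq> s"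
  shows "coord r ` (fst T \<union> snd T) \<inter> coord s ` (fst T \<union> snd T) = {}"
proof -
  have "\<forall>r\<in>{1,2,3}. \<forall>s\<in>{1,2,3}. r \<noteq> s \<longrightarrow>
        coord r ` (fst T \<union> snd T) \<inter> coord s ` (fst T \<union> snd T) = {}"
    using T unfolding latin_bitrade_def by (elim conjE)
  from this[rule_format, OF rs] show ?thesis .
qed

text \<open>(R3) supplies the map; it is injective by uniqueness in (R2), and onto because the mate
  given by (R2) is sent back by uniqueness in (R3). Each pair of coordinates has its own such
  bijection, along which sums are reindexed.\<close>

lemma bitrade_mate:
  assumes "latin_bitrade T" "r \<in> {1,2,3}" "s \<in> {1,2,3}" "r \<noteq> s"
  obtains \<pi> where "bij_betw \<pi> (snd T) (fst T)"
    "\<And>b. b \<in> snd T \<Longrightarrow> coord r (\<pi> b) = coord r b"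
    "\<And>b. b \<in> snd T \<Longrightarrow> coord s (\<pi> b) = coord s b"
proof -
  note ex = latin_bitrade_white_mate[OF assms(1) _ assms(2-4)]
    and ex' = latin_bitrade_black_mate[OF assms(1) _ assms(2-4)]
  have "\<forall>q\<in>snd T. \<exists>p. p \<in> fst T \<and> coord r q = coord r p \<and> coord s q = coord s p"
    using ex by blast
  then obtain \<pi> where \<pi>: "\<forall>q\<in>snd T. \<pi> q \<in> fst T \<and> coord r q = coord r (\<pi> q) \<and> coord s q = coord s (\<pi> q)"
    by metis
  have "inj_on \<pi> (snd T)"
    using \<pi> ex' unfolding inj_on_def by metis
  moreover have "\<pi> ` snd T = fst T"
  proof
    show "\<pi> ` snd T \<subseteq> fst T" using \<pi> by blast
    show "fst T \<subseteq> \<pi> ` snd T"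
    proof
      fix p assume p: "p \<in> fst T"
      then obtain q where q: "q \<in> snd T" "coord r p = coord r q" "coord s p = coord s q"
        using ex' by blast
      then have "\<pi> q = p" using \<pi> ex p by metis
      then show "p \<in> \<pi> ` snd T" using q(1) by blast
    qed
  qed
  ultimately show thesis using that \<pi> unfolding bij_betw_def by metis
qed

lemma bitrade_share_unique:
  assumes "latin_bitrade T" "r \<in> {1,2,3}" "s \<in> {1,2,3}" "r \<noteq> s"
    and "b \<in> snd T" "p \<in> fst T" "q \<in> fst T"
    and "coord r p = coord r b" "coord s p = coord s b"
    and "coord r q = coord r b" "coord s q = coord s b"
  shows "p = q"
proof -
  have "\<exists>!p. p \<in> fst T \<and> coord r b = coord r p \<and> coord s b = coord s p"
    by (rule latin_bitrade_white_mate[OF assms(1,5,2-4)])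
  then show ?thesis using assms(6-) by metis
qed

text \<open>With \<open>f\<close> a product of two indicators this equates the entries of W'W and
  B'B. The case \<open>r = s\<close> is the diagonal: a label lies on equally many triples of either
  mate.\<close>

lemma bitrade_sum_pair:
  fixes f :: "'a \<Rightarrow> 'a \<Rightarrow> 'b::comm_monoid_add"
  assumes "latin_bitrade T" "r \<in> {1,2,3}" "s \<in> {1,2,3}"
  shows "(\<Sum>b\<in>snd T. f (coord r b) (coord s b)) = (\<Sum>w\<in>fst T. f (coord r w) (coord s w))"
proof -
  \<comment> \<open>For \<open>r = s\<close> any second index serves, since only agreement in
    \<open>r\<close> matters then.\<close>
  have "\<exists>t\<in>{1,2,3}. t \<noteq> r \<and> (r \<noteq> s \<longrightarrow> t = s)"
    using assms(2,3) by auto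
  then obtain t where t: "t \<in> {1,2,3}" "t \<noteq> r" "r \<noteq> s \<longrightarrow> t = s" by blast
  obtain \<pi> where \<pi>: "bij_betw \<pi> (snd T) (fst T)"
    "\<And>b. b \<in> snd T \<Longrightarrow> coord r (\<pi> b) = coord r b"
    "\<And>b. b \<in> snd T \<Longrightarrow> coord t (\<pi> b) = coord t b"
    using bitrade_mate[OF assms(1,2) t(1)] t(2) by metis
  have "(\<Sum>w\<in>fst T. f (coord r w) (coord s w)) = (\<Sum>b\<in>snd T. f (coord r (\<pi> b)) (coord s (\<pi> b)))"
    by (rule sum.reindex_bij_betw[OF \<pi>(1), symmetric])
  also have "\<dots> = (\<Sum>b\<in>snd T. f (coord r b) (coord s b))"
    using \<pi>(2,3) t(3) by (intro sum.cong refl) (cases "r = s"; auto)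
  finally show ?thesis by simp
qed

section \<open>Sub-bitrades and indecomposability\<close>

lemma latin_bitrade_restrict:
  assumes T: "latin_bitrade T"
    and P: "\<And>w b r s. \<lbrakk>w \<in> fst T; b \<in> snd T; r \<in> {1,2,3}; s \<in> {1,2,3}; r \<noteq> s;
      coord r w = coord r b; coord s w = coord s b\<rbrakk> \<Longrightarrow> P w \<longleftrightarrow> P b"
  shows "latin_bitrade ({w \<in> fst T. P w}, {b \<in> snd T. P b})"
  unfolding latin_bitrade_def fst_conv snd_conv
proof (intro conjI ballI impI)
  show "finite {w \<in> fst T. P w}" "finite {b \<in> snd T. P b}"
    using latin_bitrade_finite[OF T] by simp_all
  have "fst T \<inter> snd T = {}" using T unfolding latin_bitrade_def by (elim conjE)
  then show "{w \<in> fst T. P w} \<inter> {b \<in> snd T. P b} = {}" by blast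
next
  fix r s :: nat assume rs: "r \<in> {1,2,3}" "s \<in> {1,2,3}" "r \<noteq> s"
  have "coord r ` (fst T \<union> snd T) \<inter> coord s ` (fst T \<union> snd T) = {}"
    by (rule latin_bitrade_labels_disjoint[OF T rs])
  then show "coord r ` ({w \<in> fst T. P w} \<union> {b \<in> snd T. P b}) \<inter>
      coord s ` ({w \<in> fst T. P w} \<union> {b \<in> snd T. P b}) = {}"
    by blast
next
  fix p and r s :: nat
  assume p: "p \<in> {w \<in> fst T. P w}" and rs: "r \<in> {1,2,3}" "s \<in> {1,2,3}" "r \<noteq> s"
  have "\<exists>!q. q \<in> snd T \<and> coord r p = coord r q \<and> coord s p = coord s q"
    using latin_bitrade_black_mate[OF T _ rs] p by blast
  then show "\<exists>!q. q \<in> {b \<in> snd T. P b} \<and> coord r p = coord r q \<and> coord s p = coord s q"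
    using P[OF _ _ rs] p by (metis (mono_tags, lifting) mem_Collect_eq)
next
  fix q and r s :: nat
  assume q: "q \<in> {b \<in> snd T. P b}" and rs: "r \<in> {1,2,3}" "s \<in> {1,2,3}" "r \<noteq> s"
  have "\<exists>!p. p \<in> fst T \<and> coord r q = coord r p \<and> coord s q = coord s p"
    using latin_bitrade_white_mate[OF T _ rs] q by blast
  then show "\<exists>!p. p \<in> {w \<in> fst T. P w} \<and> coord r q = coord r p \<and> coord s q = coord s p"
    using P[OF _ _ rs] q by (metis (mono_tags, lifting) mem_Collect_eq)
qed

lemma three_indices:
  assumes "{i,j,k} = {1,2,3::nat}"
  shows "i \<in> {1,2,3}" "j \<in> {1,2,3}" "k \<in> {1,2,3}" "i \<noteq> j" "i \<noteq> k" "j \<noteq> k"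
proof -
  have "card {i,j,k} = 3" using assms by simp
  then show "i \<noteq> j" "i \<noteq> k" "j \<noteq> k" by (auto simp: card_insert_if split: if_splits)
qed (use assms in auto)

lemma other_indices:
  assumes "i \<in> {1,2,3::nat}"
  obtains j k where "{i,j,k} = {1,2,3}"
proof -
  have "{1,2,3} = {1,2,3::nat}" "{2,1,3} = {1,2,3::nat}" "{3,1,2} = {1,2,3::nat}" by auto
  then show thesis using assms that by blast
qed

text \<open>Closure is asked in one direction and for one pair of coordinates; counting yields the
  rest. Both mates have equally many triples over \<open>R\<close>, so the injection \<pi> along
  \<open>j\<close> and \<open>k\<close> maps those of \<open>snd T\<close> onto those of
  \<open>fst T\<close>. Hence triples of the two mates sharing two coordinates agree on membership,
  \<open>R\<close> and its complement split \<open>T\<close>, and indecomposability empties the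
  complement.\<close>

lemma indecomposable_closed:
  assumes T: "latin_bitrade T" "indecomposable T" and ijk: "{i,j,k} = {1,2,3}"
    and closed: "\<And>w b. \<lbrakk>w \<in> fst T; b \<in> snd T; coord j w = coord j b; coord k w = coord k b;
      coord i b \<in> R\<rbrakk> \<Longrightarrow> coord i w \<in> R"
    and w0: "w0 \<in> fst T" "coord i w0 \<in> R" and w: "w \<in> fst T"
  shows "coord i w \<in> R"
proof -
  note I = three_indices[OF ijk]
  let ?P = "\<lambda>p. coord i p \<in> R"
  let ?W = "{w \<in> fst T. ?P w}" and ?B = "{b \<in> snd T. ?P b}"
  note fin = latin_bitrade_finite[OF T(1)]
  obtain \<pi> where \<pi>: "bij_betw \<pi> (snd T) (fst T)"
    "\<And>b. b \<in> snd T \<Longrightarrow> coord j (\<pi> b) = coord j b"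
    "\<And>b. b \<in> snd T \<Longrightarrow> coord k (\<pi> b) = coord k b"
    using bitrade_mate[OF T(1) I(2,3,6)] by metis
  have "(\<Sum>b\<in>snd T. if ?P b then 1 else 0::nat) = (\<Sum>w\<in>fst T. if ?P w then 1 else 0)"
    by (rule bitrade_sum_pair[OF T(1) I(1,1), where f = "\<lambda>x _. if x \<in> R then 1 else 0"])
  then have "card ?B = card ?W"
    using fin by (simp add: sum.If_cases Int_def conj_commute)
  moreover have "card (\<pi> ` ?B) = card ?B"
    using \<pi>(1) unfolding bij_betw_def by (intro card_image) (auto intro: inj_on_subset)
  moreover have "\<pi> ` ?B \<subseteq> ?W"
    using closed[OF _ _ \<pi>(2,3)] bij_betwE[OF \<pi>(1)] by blast
  ultimately have eq: "\<pi> ` ?B = ?W"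
    using fin by (intro card_subset_eq) auto
  have iff: "?P w \<longleftrightarrow> ?P b" if A: "w \<in> fst T" "b \<in> snd T" "r \<in> {1,2,3}" "s \<in> {1,2,3}" "r \<noteq> s"
      "coord r w = coord r b" "coord s w = coord s b" for w b r s
  proof (cases "r = i \<or> s = i")
    case True then show ?thesis using A by auto
  next
    case False
    then have "r = j \<and> s = k \<or> r = k \<and> s = j"
      using A(3-5) unfolding ijk[symmetric] by blast
    then have sh: "coord j w = coord j b" "coord k w = coord k b"
      using A(6,7) by auto
    have "\<pi> b \<in> fst T" using \<pi>(1) A(2) unfolding bij_betw_def by blast
    from bitrade_share_unique[OF T(1) I(2,3,6) A(2) this A(1) \<pi>(2)[OF A(2)] \<pi>(3)[OF A(2)] sh]
    have "\<pi> b = w" .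
    moreover have "?P b" if "?P w"
    proof -
      from that A(1) eq obtain b' where b': "b' \<in> ?B" "w = \<pi> b'" by blast
      then have "b' = b" using \<pi>(1) A(2) \<open>\<pi> b = w\<close> unfolding bij_betw_def inj_on_def by blast
      then show ?thesis using b' by blast
    qed
    ultimately show ?thesis using closed[OF A(1,2) sh] by blast
  qed
  define U V where "U = (?W, ?B)" and "V = ({w \<in> fst T. \<not> ?P w}, {b \<in> snd T. \<not> ?P b})"
  have "latin_bitrade U" unfolding U_def by (rule latin_bitrade_restrict[OF T(1) iff])
  moreover have "latin_bitrade V" unfolding V_def
    by (rule latin_bitrade_restrict[OF T(1) arg_cong[where f = Not, OF iff]])
  moreover have "fst T = fst U \<union> fst V" "snd T = snd U \<union> snd V"
    "fst U \<inter> fst V = {}" "snd U \<inter> snd V = {}"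
    unfolding U_def V_def fst_conv snd_conv by blast+
  moreover have "U \<noteq> ({},{})"
  proof
    assume "U = ({},{})"
    then have "?W = {}" unfolding U_def by (rule Pair_inject)
    then show False using w0 by blast
  qed
  ultimately have "V = ({},{})"
    using T(2) unfolding indecomposable_def by blast
  then have "{w \<in> fst T. \<not> ?P w} = {}" unfolding V_def by (rule Pair_inject)
  then show ?thesis using w by blast
qed

section \<open>Weights killed by the incidence matrix\<close>

definition trisum :: "(nat \<Rightarrow> 'a \<Rightarrow> rat) \<Rightarrow> 'a triple \<Rightarrow> rat" where
  "trisum X p = (\<Sum>i\<in>{1,2,3}. X i (coord i p))"

lemma trisum_indices:
  assumes "{i,j,k} = {1,2,3}"
  shows "trisum X p = X i (coord i p) + X j (coord j p) + X k (coord k p)"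
  unfolding trisum_def assms[symmetric] using three_indices[OF assms] by simp

text \<open>The entry at \<open>l\<close> of W'W X = B'B X: the transpose sums the values of
  \<open>trisum X\<close> over the triples through \<open>l\<close>.\<close>

lemma bitrade_sum_coord:
  assumes "latin_bitrade T" "i \<in> {1,2,3}"
  shows "(\<Sum>b\<in>snd T. if coord i b = l then trisum X b else 0) =
    (\<Sum>w\<in>fst T. if coord i w = l then trisum X w else 0)"
proof -
  have *: "(\<Sum>b\<in>S. if coord i b = l then trisum X b else 0) =
    (\<Sum>j\<in>{1,2,3}. \<Sum>b\<in>S. if coord i b = l then X j (coord j b) else 0)" for S
  proof -
    have "(\<Sum>b\<in>S. if coord i b = l then trisum X b else 0) =
        (\<Sum>b\<in>S. \<Sum>j\<in>{1,2,3}. if coord i b = l then X j (coord j b) else 0)"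
      by (intro sum.cong[OF refl]) (simp add: trisum_def)
    also have "\<dots> = (\<Sum>j\<in>{1,2,3}. \<Sum>b\<in>S. if coord i b = l then X j (coord j b) else 0)"
      by (rule sum.swap)
    finally show ?thesis .
  qed
  have "(\<Sum>b\<in>snd T. if coord i b = l then X j (coord j b) else 0) =
    (\<Sum>w\<in>fst T. if coord i w = l then X j (coord j w) else 0)" if "j \<in> {1,2,3}" for j
    by (rule bitrade_sum_pair[OF assms that, where f = "\<lambda>x y. if x = l then X j y else 0"])
  then show ?thesis unfolding * by (rule sum.cong[OF refl])
qed

text \<open>This is the identity W'W = B'B as an equality of quadratic forms.\<close>
lemma bitrade_sum_square:
  assumes "latin_bitrade T"
  shows "(\<Sum>b\<in>snd T. (trisum X b)\<^sup>2) = (\<Sum>w\<in>fst T. (trisum X w)\<^sup>2)"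
proof -
  have *: "(\<Sum>b\<in>S. (trisum X b)\<^sup>2) =
    (\<Sum>i\<in>{1,2,3}. \<Sum>j\<in>{1,2,3}. \<Sum>b\<in>S. X i (coord i b) * X j (coord j b))" for S
    unfolding trisum_def power2_eq_square sum_product
    by (subst sum.swap, rule sum.cong[OF refl], rule sum.swap)
  have "(\<Sum>b\<in>snd T. X i (coord i b) * X j (coord j b)) =
    (\<Sum>w\<in>fst T. X i (coord i w) * X j (coord j w))" if "i \<in> {1,2,3}" "j \<in> {1,2,3}" for i j
    by (rule bitrade_sum_pair[OF assms that, where f = "\<lambda>x y. X i x * X j y"])
  then show ?thesis unfolding * by (rule sum.cong[OF refl sum.cong[OF refl]])
qed

text \<open>Over the rationals a vanishing sum of squares makes \<open>trisum X\<close> zero on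
  \<open>snd T\<close> too. Triples of the two mates sharing coordinates \<open>j\<close> and
  \<open>k\<close> then have equal weight at \<open>i\<close>, so level sets of \<open>X i\<close>
  are closed under adjacency.\<close>

lemma trisum_zero_constant:
  assumes T: "latin_bitrade T" "indecomposable T" and i: "i \<in> {1,2,3}"
    and X: "\<And>w. w \<in> fst T \<Longrightarrow> trisum X w = 0"
    and w: "w \<in> fst T" "w' \<in> fst T"
  shows "X i (coord i w) = X i (coord i w')"
proof -
  obtain j k where ijk: "{i,j,k} = {1,2,3}" using other_indices[OF i] .
  have "(\<Sum>b\<in>snd T. (trisum X b)\<^sup>2) = 0"
    using bitrade_sum_square[OF T(1), of X] X by simp
  then have B: "trisum X b = 0" if "b \<in> snd T" for b
    using latin_bitrade_finite(2)[OF T(1)] that by (simp add: sum_nonneg_eq_0_iff)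
  have "coord i w \<in> {l. X i l = X i (coord i w')}"
  proof (rule indecomposable_closed[OF T ijk _ w(2) _ w(1)])
    fix v b assume "v \<in> fst T" "b \<in> snd T" "coord j v = coord j b" "coord k v = coord k b"
      "coord i b \<in> {l. X i l = X i (coord i w')}"
    then show "coord i v \<in> {l. X i l = X i (coord i w')}"
      using X[of v] B[of b] unfolding trisum_indices[OF ijk] by simp
  qed simp
  then show ?thesis by simp
qed

section \<open>Existence of dual solutions\<close>

text \<open>Gaussian elimination, by induction on the equations: a zero equation is dropped, any
  other is solved for one unknown \<open>p\<close>, leaving one equation and one unknown
  fewer.\<close>

lemma underdetermined_nontrivial:
  fixes A :: "'e \<Rightarrow> 'v \<Rightarrow> 'f::field"
  assumes "finite E" "finite V" "card E < card V"
  shows "\<exists>x. (\<exists>v\<in>V. x v \<noteq> 0) \<and> (\<forall>e\<in>E. (\<Sum>v\<in>V. A e v * x v) = 0)"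
  using assms
proof (induction E arbitrary: V A rule: finite_induct)
  case empty
  then have "V \<noteq> {}" by auto
  then show ?case by (intro exI[of _ "\<lambda>_. 1"]) auto
next
  case (insert e E)
  show ?case
  proof (cases "\<forall>v\<in>V. A e v = 0")
    case True
    have "card E < card V" using insert by simp
    from insert.IH[OF insert.prems(1) this, of A] show ?thesis using True by auto
  next
    case False
    then obtain p where p: "p \<in> V" "A e p \<noteq> 0" by blast
    let ?V = "V - {p}"
    have c: "card E < card ?V" using insert p by simp
    obtain x where x: "\<exists>v\<in>?V. x v \<noteq> 0"
      "\<forall>e'\<in>E. (\<Sum>v\<in>?V. (A e' v - A e' p * A e v / A e p) * x v) = 0"
      using insert.IH[OF _ c, of "\<lambda>e' v. A e' v - A e' p * A e v / A e p"] insert.prems by auto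
    \<comment> \<open>The value at \<open>p\<close> is the one that equation \<open>e\<close>
      forces.\<close>
    define y where "y = x(p := - (\<Sum>v\<in>?V. A e v * x v) / A e p)"
    have y: "(\<Sum>v\<in>V. A e' v * y v) = A e' p * y p + (\<Sum>v\<in>?V. A e' v * x v)" for e'
    proof -
      have "(\<Sum>v\<in>V. A e' v * y v) = A e' p * y p + (\<Sum>v\<in>?V. A e' v * y v)"
        by (rule sum.remove[OF insert.prems(1) p(1)])
      also have "(\<Sum>v\<in>?V. A e' v * y v) = (\<Sum>v\<in>?V. A e' v * x v)"
        by (intro sum.cong) (auto simp: y_def)
      finally show ?thesis .
    qed
    have "(\<Sum>v\<in>V. A e v * y v) = 0" unfolding y using p by (simp add: y_def)
    moreover have "(\<Sum>v\<in>V. A e' v * y v) = 0" if "e' \<in> E" for e'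
    proof -
      have "0 = (\<Sum>v\<in>?V. A e' v * x v) - (\<Sum>v\<in>?V. A e' p / A e p * (A e v * x v))"
        using x(2) that by (simp add: sum_subtractf[symmetric] algebra_simps)
      also have "(\<Sum>v\<in>?V. A e' p / A e p * (A e v * x v)) = - (A e' p * y p)"
        unfolding sum_distrib_left[symmetric] by (simp add: y_def)
      finally show ?thesis unfolding y by (simp add: add.commute)
    qed
    moreover have "\<exists>v\<in>V. y v \<noteq> 0" using x(1) by (auto simp: y_def)
    ultimately show ?thesis by blast
  qed
qed

text \<open>Fixing the values at one row and one column of the distinguished triple and dropping its
  equation leaves one more unknown than equations.\<close>
lemma dual_solution_exists:
  assumes T: "latin_bitrade T" "spherical T" and w0: "w0 \<in> fst T"
  shows "\<exists>X. \<forall>w\<in>fst T. trisum X w = of_bool (w = w0)"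
proof -
  have ind: "indecomposable T"
    and m: "(\<Sum>i\<in>{1,2,3}. card (coord i ` fst T)) = card (fst T) + 2"
    using T(2) unfolding spherical_def by blast+
  note fin = latin_bitrade_finite(1)[OF T(1)]
  \<comment> \<open>Labels are tagged with their kind, so \<open>?S\<close> has m elements; removing
    two leaves exactly as many unknowns as there are triples.\<close>
  let ?S = "Sigma {1,2,3} (\<lambda>i. coord i ` fst T)"
  define V where "V = ?S - {(1, coord 1 w0), (2, coord 2 w0)}"
  have finS: "finite ?S" using fin by auto
  then have finV: "finite V" unfolding V_def by blast
  have "card ?S = card (fst T) + 2" using m fin by (subst card_SigmaI) auto
  then have "card V = card (fst T)"
    unfolding V_def using w0 finS by (subst card_Diff_subset) auto
  then have "card (fst T - {w0}) < card V"
    using w0 fin by (metis card_Diff1_less)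
  then obtain x where x: "\<exists>v\<in>V. x v \<noteq> 0"
    "\<forall>e\<in>fst T - {w0}. (\<Sum>v\<in>V. (of_bool (coord (fst v) e = snd v) :: rat) * x v) = 0"
    using underdetermined_nontrivial[of "fst T - {w0}" V
        "\<lambda>e v. (of_bool (coord (fst v) e = snd v) :: rat)"] fin finV by auto
  \<comment> \<open>The default 0 is what fixes the values at the chosen row and column.\<close>
  define X where "X = (\<lambda>i l. if (i,l) \<in> V then x (i,l) else 0)"
  have tri: "(\<Sum>v\<in>V. of_bool (coord (fst v) e = snd v) * x v) = trisum X e" if e: "e \<in> fst T" for e
  proof -
    have "(\<Sum>v\<in>V. of_bool (coord (fst v) e = snd v) * x v) =
        (\<Sum>v\<in>V. of_bool (coord (fst v) e = snd v) * X (fst v) (snd v))"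
      by (intro sum.cong) (auto simp: X_def)
    also have "\<dots> = (\<Sum>v\<in>?S. of_bool (coord (fst v) e = snd v) * X (fst v) (snd v))"
      by (intro sum.mono_neutral_left finS) (auto simp: V_def X_def)
    also have "\<dots> = (\<Sum>i\<in>{1,2,3}. \<Sum>l\<in>coord i ` fst T. of_bool (coord i e = l) * X i l)"
      using fin by (subst sum.Sigma) (auto simp: case_prod_unfold)
    also have "\<dots> = trisum X e" unfolding trisum_def
      using e fin by (intro sum.cong refl) (simp add: sum.delta' of_bool_def if_distrib if_distribR cong: if_cong)
    finally show ?thesis .
  qed
  define t where "t = trisum X w0"
  have X: "trisum X w = t * of_bool (w = w0)" if "w \<in> fst T" for w
    using x(2) tri[OF that] that by (cases "w = w0") (auto simp: t_def)
  \<comment> \<open>If the dropped equation also had value 0, \<open>X\<close> would be constant on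
    each kind. Being 0 at the row and column of \<open>w0\<close>, it would be 0 at its symbol and
    so everywhere, against nontriviality. Hence \<open>X\<close> can be rescaled by
    \<open>t\<close>.\<close>
  have "t \<noteq> 0"
  proof
    assume "t = 0"
    then have z: "trisum X w = 0" if "w \<in> fst T" for w using X that by simp
    have c: "X i (coord i w) = X i (coord i w0)" if "w \<in> fst T" "i \<in> {1,2,3}" for i w
      by (rule trisum_zero_constant[OF T(1) ind that(2) z that(1) w0])
    have "X 1 (coord 1 w0) = 0" "X 2 (coord 2 w0) = 0" by (auto simp: X_def V_def)
    moreover from this have "X 3 (coord 3 w0) = 0"
      using z[OF w0] by (simp add: trisum_def)
    ultimately have "X i (coord i w) = 0" if "w \<in> fst T" "i \<in> {1,2,3}" for i w
      using c[OF that] that(2) by auto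
    moreover obtain i l where il: "(i,l) \<in> V" "x (i,l) \<noteq> 0" using x(1) by auto
    moreover from il(1) obtain w where "w \<in> fst T" "i \<in> {1,2,3}" "l = coord i w"
      unfolding V_def by blast
    ultimately show False unfolding X_def by metis
  qed
  have "trisum (\<lambda>i l. X i l / t) w = of_bool (w = w0)" if "w \<in> fst T" for w
  proof -
    have "trisum (\<lambda>i l. X i l / t) w = trisum X w / t"
      unfolding trisum_def by (rule sum_divide_distrib[symmetric])
    then show ?thesis using X[OF that] \<open>t \<noteq> 0\<close> by simp
  qed
  then show ?thesis by blast
qed

section \<open>The maximum principle\<close>

text \<open>On the labels attaining the maximum, the weights of the incident triples of the second mate
  are nonnegative and sum to zero, so the set of these labels is closed under adjacency.\<close>
lemma dual_solution_max:
  assumes T: "latin_bitrade T" "indecomposable T" and w0: "w0 \<in> fst T"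
    and X: "\<forall>w\<in>fst T. trisum X w = of_bool (w = w0)"
    and i: "i \<in> {1,2,3}" and w: "w \<in> fst T"
  shows "X i (coord i w) \<le> X i (coord i w0)"
proof -
  obtain j k where ijk: "{i,j,k} = {1,2,3}" using other_indices[OF i] .
  note I = three_indices[OF ijk] and fin = latin_bitrade_finite[OF T(1)]
  define M where "M = Max ((\<lambda>w. X i (coord i w)) ` fst T)"
  have le: "X i (coord i v) \<le> M" if "v \<in> fst T" for v
    unfolding M_def using that fin by simp
  have "M \<in> (\<lambda>w. X i (coord i w)) ` fst T"
    unfolding M_def using w0 fin by (intro Max_in) auto
  then obtain v0 where v0: "v0 \<in> fst T" "X i (coord i v0) = M" by auto
  have "X i (coord i w0) = M"
  proof (rule ccontr)
    assume ne: "X i (coord i w0) \<noteq> M"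
    have tri: "trisum X b = X i (coord i b) - X i (coord i v) + of_bool (v = w0)"
      if "v \<in> fst T" "coord j v = coord j b" "coord k v = coord k b" for v b
      using X[rule_format, OF that(1)] that(2,3) unfolding trisum_indices[OF ijk] by simp
    have "coord i w0 \<in> {l. X i l = M}"
    proof (rule indecomposable_closed[OF T ijk _ v0(1) _ w0])
      fix v b assume A: "v \<in> fst T" "b \<in> snd T" "coord j v = coord j b" "coord k v = coord k b"
        and R: "coord i b \<in> {l. X i l = M}"
      let ?l = "coord i b"
      \<comment> \<open>The mate of \<open>b'\<close> along \<open>j\<close> and \<open>k\<close>
        has weight at most \<open>M\<close> at \<open>i\<close>, while \<open>b'\<close> has exactly
        \<open>M\<close>.\<close>
      have nn: "0 \<le> (if coord i b' = ?l then trisum X b' else 0)" if b': "b' \<in> snd T" for b'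
      proof -
        obtain v' where "v' \<in> fst T" "coord j v' = coord j b'" "coord k v' = coord k b'"
          using latin_bitrade_white_mate[OF T(1) b' I(2,3,6)] by metis
        then show ?thesis using tri[of v' b'] le[of v'] R by auto
      qed
      have "(\<Sum>b'\<in>snd T. if coord i b' = ?l then trisum X b' else 0) =
          (\<Sum>w\<in>fst T. if coord i w = ?l then trisum X w else 0)"
        by (rule bitrade_sum_coord[OF T(1) i])
      \<comment> \<open>No triple of \<open>fst T\<close> through \<open>?l\<close> is
        \<open>w0\<close>, whose label is below the maximum by \<open>ne\<close>.\<close>
      also have "\<dots> = 0"
        using X ne R by (intro sum.neutral) auto
      finally have "(if coord i b = ?l then trisum X b else 0) = 0"
        using nn A(2) fin(2) by (subst (asm) sum_nonneg_eq_0_iff) auto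
      \<comment> \<open>The indicator of \<open>v = w0\<close> has the favourable sign: it could
        only raise the weight of \<open>v\<close>.\<close>
      then have "X i (coord i v) \<ge> M" using tri[OF A(1,3,4)] R by (auto simp: of_bool_def split: if_splits)
      then show "coord i v \<in> {l. X i l = M}" using le[OF A(1)] by simp
    qed (use v0 in simp)
    then show False using ne by simp
  qed
  then show ?thesis using le[OF w] by simp
qed

text \<open>The maxima of the three kinds sum to 1, so a triple of weight 0 through a label at least
  1 below its maximum must lie exactly 1 below it, and at the maxima of the other two kinds. The set
  \<open>Z\<close> of such labels is closed under adjacency except possibly at \<open>w0\<close>.
  Counting excludes this exception, so \<open>Z\<close> would contain the label of
  \<open>w0\<close>, which is impossible.\<close>

lemma dual_solution_gt:
  assumes T: "latin_bitrade T" "indecomposable T" and w0: "w0 \<in> fst T"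
    and X: "\<forall>w\<in>fst T. trisum X w = of_bool (w = w0)"
    and i: "i \<in> {1,2,3}" and w: "w \<in> fst T"
  shows "X i (coord i w) > X i (coord i w0) - 1"
proof (rule ccontr)
  obtain j k where ijk: "{i,j,k} = {1,2,3}" using other_indices[OF i] .
  note I = three_indices[OF ijk] and fin = latin_bitrade_finite[OF T(1)]
  note max = dual_solution_max[OF T w0 X]
  assume "\<not> X i (coord i w) > X i (coord i w0) - 1"
  then have wle: "X i (coord i w) \<le> X i (coord i w0) - 1" by simp
  define Z where "Z = {l. X i l = X i (coord i w0) - 1}"
  have M: "X i (coord i w0) + X j (coord j w0) + X k (coord k w0) = 1"
    using X[rule_format, OF w0] unfolding trisum_indices[OF ijk] by simp
  have white: "X i (coord i v) + X j (coord j v) + X k (coord k v) = 0" if "v \<in> fst T" "v \<noteq> w0" for v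
    using X[rule_format, OF that(1)] that(2) unfolding trisum_indices[OF ijk] by simp
  have w0Z: "coord i w0 \<notin> Z" by (simp add: Z_def)
  have wZ: "coord i w \<in> Z"
  proof -
    have "w \<noteq> w0" using wle by auto
    then show ?thesis
      using white[OF w] M max[OF I(2) w] max[OF I(3) w] wle by (simp add: Z_def)
  qed
  have corner: "X j (coord j v) = X j (coord j w0)" "X k (coord k v) = X k (coord k w0)"
    if v: "v \<in> fst T" "coord i v \<in> Z" for v
  proof -
    have "v \<noteq> w0" using v w0Z by auto
    from white[OF v(1) this] show "X j (coord j v) = X j (coord j w0)" "X k (coord k v) = X k (coord k w0)"
      using M max[OF I(2) v(1)] max[OF I(3) v(1)] v(2) by (simp_all add: Z_def)
  qed
  \<comment> \<open>Two different mates of \<open>b\<close> are used, each sharing the label in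
    \<open>Z\<close> and one of the other labels.\<close>
  have bcorner: "X j (coord j b) = X j (coord j w0)" "X k (coord k b) = X k (coord k w0)"
    if b: "b \<in> snd T" "coord i b \<in> Z" for b
  proof -
    obtain v where "v \<in> fst T" "coord i v = coord i b" "coord j v = coord j b"
      using latin_bitrade_white_mate[OF T(1) b(1) I(1,2,4)] by metis
    then show "X j (coord j b) = X j (coord j w0)" using corner(1)[of v] b(2) by simp
    obtain v where "v \<in> fst T" "coord i v = coord i b" "coord k v = coord k b"
      using latin_bitrade_white_mate[OF T(1) b(1) I(1,3,5)] by metis
    then show "X k (coord k b) = X k (coord k w0)" using corner(2)[of v] b(2) by simp
  qed
  have step: "coord i v \<in> Z"
    if A: "v \<in> fst T" "b \<in> snd T" "coord j v = coord j b" "coord k v = coord k b" "coord i b \<in> Z" "v \<noteq> w0" for v b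
    using white[OF A(1,6)] bcorner[OF A(2,5)] A(3,4) M by (simp add: Z_def)
  obtain \<pi> where \<pi>: "bij_betw \<pi> (snd T) (fst T)"
    "\<And>b. b \<in> snd T \<Longrightarrow> coord j (\<pi> b) = coord j b"
    "\<And>b. b \<in> snd T \<Longrightarrow> coord k (\<pi> b) = coord k b"
    using bitrade_mate[OF T(1) I(2,3,6)] by metis
  \<comment> \<open>Counting columns and symbols over Z shows that a defect at the corner of w0 would have to be
    compensated by a triple of T* with the same column and symbol as w0, that is by w0 itself.\<close>
  have nodefect: "\<pi> b \<noteq> w0" if b: "b \<in> snd T" "coord i b \<in> Z" for b
  proof
    assume \<pi>b: "\<pi> b = w0"
    let ?W = "{v \<in> fst T. coord i v \<in> Z}" and ?B = "{b \<in> snd T. coord i b \<in> Z}"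
    have finW: "finite ?W" "finite ?B" using fin by auto
    have inj: "inj_on \<pi> (?B - {b})" using \<pi>(1) unfolding bij_betw_def by (blast intro: inj_on_subset)
    have ZZ: "(\<Sum>b\<in>?B. f (coord s b)) = (\<Sum>v\<in>?W. f (coord s v))"
      if "s \<in> {1,2,3}" for f :: "'a \<Rightarrow> int" and s
    proof -
      have "(\<Sum>b\<in>snd T. if coord i b \<in> Z then f (coord s b) else 0) =
          (\<Sum>v\<in>fst T. if coord i v \<in> Z then f (coord s v) else 0)"
        by (rule bitrade_sum_pair[OF T(1) i that, where f = "\<lambda>x y. if x \<in> Z then f y else 0"])
      then show ?thesis by (simp only: sum.inter_filter[OF fin(1)] sum.inter_filter[OF fin(2)])
    qed
    have sub: "\<pi> ` (?B - {b}) \<subseteq> ?W"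
    proof
      fix v assume "v \<in> \<pi> ` (?B - {b})"
      then obtain b' where b': "b' \<in> snd T" "coord i b' \<in> Z" "b' \<noteq> b" "v = \<pi> b'" by blast
      have "v \<noteq> w0" using b' \<pi>b b \<pi>(1) unfolding bij_betw_def inj_on_def by blast
      moreover have "v \<in> fst T" using b' \<pi>(1) unfolding bij_betw_def by blast
      ultimately show "v \<in> ?W" using step[of v b'] b' \<pi>(2,3) by blast
    qed
    have "card ?B = card ?W" using ZZ[OF I(1), of "\<lambda>_. 1"] by simp
    moreover have "card (\<pi> ` (?B - {b})) = card ?B - 1"
      using card_image[OF inj] b by simp
    moreover have "b \<in> ?B" using b by blast
    then have "card ?B > 0" using finW(2) card_gt_0_iff by blast
    \<comment> \<open>Only \<open>b\<close> was left out, so the image misses exactly one triple of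
      \<open>?W\<close>.\<close>
    ultimately have "card (?W - \<pi> ` (?B - {b})) = 1"
      using sub finW by (simp add: card_Diff_subset)
    then obtain v where v: "?W - \<pi> ` (?B - {b}) = {v}" by (rule card_1_singletonE)
    have eq: "coord s v = coord s w0" if s: "s \<in> {1,2,3}" "\<And>b. b \<in> snd T \<Longrightarrow> coord s (\<pi> b) = coord s b" for s
    proof -
      let ?f = "\<lambda>l. of_bool (l = coord s w0) :: int"
      have "(\<Sum>v\<in>?W. ?f (coord s v)) = (\<Sum>v\<in>?W - \<pi> ` (?B - {b}). ?f (coord s v)) + (\<Sum>v\<in>\<pi> ` (?B - {b}). ?f (coord s v))"
        by (rule sum.subset_diff[OF sub finW(1)])
      also have "(\<Sum>v\<in>\<pi> ` (?B - {b}). ?f (coord s v)) = (\<Sum>b\<in>?B - {b}. ?f (coord s b))"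
        using s(2) by (subst sum.reindex[OF inj]) (auto intro!: sum.cong)
      also have "\<dots> = (\<Sum>b\<in>?B. ?f (coord s b)) - ?f (coord s b)"
        using b finW by (subst sum_diff1) auto
      also have "coord s b = coord s w0" using s(2)[OF b(1)] \<pi>b by simp
      finally have "?f (coord s v) = 1" using ZZ[OF s(1), of ?f] unfolding v by (simp del: sum_of_bool_eq)
      then show ?thesis by (simp split: if_splits)
    qed
    have "v = w0"
    proof (rule bitrade_share_unique[OF T(1) I(2,3,6) b(1) _ w0])
      show "v \<in> fst T" using v by blast
      show "coord j v = coord j b" "coord k v = coord k b" "coord j w0 = coord j b" "coord k w0 = coord k b"
        using eq[OF I(2) \<pi>(2)] eq[OF I(3) \<pi>(3)] \<pi>(2,3)[OF b(1)] \<pi>b by simp_all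
    qed
    then show False using v w0Z by blast
  qed
  have "coord i w0 \<in> Z"
  proof (rule indecomposable_closed[OF T ijk _ w wZ w0])
    fix v b assume A: "v \<in> fst T" "b \<in> snd T" "coord j v = coord j b" "coord k v = coord k b" "coord i b \<in> Z"
    have "\<pi> b \<in> fst T" using A(2) \<pi>(1) unfolding bij_betw_def by blast
    from bitrade_share_unique[OF T(1) I(2,3,6) A(2) this A(1) \<pi>(2)[OF A(2)] \<pi>(3)[OF A(2)] A(3,4)]
    show "coord i v \<in> Z" using step[OF A] nodefect[OF A(2,5)] by blast
  qed
  then show False using w0Z by contradiction
qed

section \<open>The groups of a bitrade\<close>

text \<open>The homomorphism from the free abelian group to the rationals extending
  \<open>f\<close>.\<close>

definition frag_eval :: "('a \<Rightarrow> rat) \<Rightarrow> ('a \<Rightarrow>\<^sub>0 int) \<Rightarrow> rat" where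
  "frag_eval f n = (\<Sum>l\<in>Poly_Mapping.keys n. of_int (Poly_Mapping.lookup n l) * f l)"

lemma frag_eval_superset:
  assumes "finite L" "Poly_Mapping.keys n \<subseteq> L"
  shows "frag_eval f n = (\<Sum>l\<in>L. of_int (Poly_Mapping.lookup n l) * f l)"
  unfolding frag_eval_def using assms
  by (intro sum.mono_neutral_left) (auto simp: in_keys_iff)

lemma frag_eval_0 [simp]: "frag_eval f 0 = 0"
  by (simp add: frag_eval_def)

lemma frag_eval_frag_of [simp]: "frag_eval f (frag_of a) = f a"
  by (subst frag_eval_superset[of "{a}"]) auto

lemma frag_eval_minus [simp]: "frag_eval f (- n) = - frag_eval f n"
  by (simp add: frag_eval_def sum_negf)

lemma frag_eval_add [simp]: "frag_eval f (m + n) = frag_eval f m + frag_eval f n"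
proof -
  let ?L = "Poly_Mapping.keys m \<union> Poly_Mapping.keys n"
  have "frag_eval f k = (\<Sum>l\<in>?L. of_int (Poly_Mapping.lookup k l) * f l)"
    if "k \<in> {m, n, m + n}" for k
    using that Poly_Mapping.keys_add[of m n] by (intro frag_eval_superset) auto
  then show ?thesis by (simp add: lookup_add sum.distrib algebra_simps)
qed

lemma frag_eval_diff [simp]: "frag_eval f (m - n) = frag_eval f m - frag_eval f n"
  using frag_eval_add[of f m "- n"] by simp

lemma frag_eval_fun_diff: "frag_eval (\<lambda>l. f l - g l) n = frag_eval f n - frag_eval g n"
  by (simp add: frag_eval_def sum_subtractf algebra_simps)

lemma frag_eval_fun_sum: "frag_eval (\<lambda>l. \<Sum>w\<in>A. c w * f w l) n = (\<Sum>w\<in>A. c w * frag_eval (f w) n)"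
proof -
  have "frag_eval (\<lambda>l. \<Sum>w\<in>A. c w * f w l) n =
      (\<Sum>l\<in>Poly_Mapping.keys n. \<Sum>w\<in>A. c w * (of_int (Poly_Mapping.lookup n l) * f w l))"
    unfolding frag_eval_def sum_distrib_left by (simp only: mult.left_commute)
  also have "\<dots> = (\<Sum>w\<in>A. c w * frag_eval (f w) n)"
    unfolding frag_eval_def sum_distrib_left by (rule sum.swap)
  finally show ?thesis .
qed

text \<open>Coefficients are themselves evaluations, so facts about all functionals give equalities
  of group elements.\<close>

lemma frag_eval_of_bool: "frag_eval (\<lambda>x. of_bool (x = l)) n = of_int (Poly_Mapping.lookup n l)"
proof -
  have "frag_eval (\<lambda>x. of_bool (x = l)) n =
      (\<Sum>x\<in>insert l (Poly_Mapping.keys n). of_int (Poly_Mapping.lookup n x) * of_bool (x = l))"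
    by (rule frag_eval_superset) auto
  also have "\<dots> = (\<Sum>x\<in>{l}. of_int (Poly_Mapping.lookup n x) * of_bool (x = l))"
    by (rule sum.mono_neutral_right) auto
  finally show ?thesis by simp
qed

section \<open>Relators, N(T) and its cosets\<close>

definition relator :: "'a triple \<Rightarrow> ('a \<Rightarrow>\<^sub>0 int)" where
  "relator w = frag_of (coord 1 w) + frag_of (coord 2 w) - frag_of (coord 3 w)"

lemma N_subgroup_relator: "N_subgroup T = generate (F_group T) (relator ` fst T)"
proof -
  have "{frag_of a1 + frag_of a2 - frag_of a3 | a1 a2 a3. (a1, a2, a3) \<in> fst T} = relator ` fst T"
    by (force simp: relator_def coord_def)
  then show ?thesis unfolding N_subgroup_def by simp
qed

definition labels :: "'a triple set \<times> 'a triple set \<Rightarrow> 'a set" where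
  "labels T = (\<Union>i\<in>{1,2,3}. coord i ` (fst T \<union> snd T))"

lemma F_group_labels: "F_group T = free_Abelian_group (labels T)"
  by (simp add: F_group_def labels_def)

lemma coord_in_labels: "w \<in> fst T \<Longrightarrow> i \<in> {1,2,3} \<Longrightarrow> coord i w \<in> labels T"
  unfolding labels_def by blast

lemma finite_labels: "latin_bitrade T \<Longrightarrow> finite (labels T)"
  unfolding labels_def using latin_bitrade_finite by blast

lemma comm_group_F_group: "comm_group (F_group T)"
  unfolding F_group_labels by (rule abelian_free_Abelian_group)

lemma group_F_group: "group (F_group T)"
  by (simp add: F_group_labels)

lemma F_group_simps [simp]:
  "x \<in> carrier (F_group T) \<longleftrightarrow> Poly_Mapping.keys x \<subseteq> labels T"
  "x \<otimes>\<^bsub>F_group T\<^esub> y = x + y" "\<one>\<^bsub>F_group T\<^esub> = 0"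
  by (simp_all add: F_group_labels)

lemma keys_diff_subset:
  "Poly_Mapping.keys x \<subseteq> L \<Longrightarrow> Poly_Mapping.keys y \<subseteq> L \<Longrightarrow> Poly_Mapping.keys (x - y) \<subseteq> L"
  using Poly_Mapping.keys_diff[of x y] by blast

lemma keys_add_subset:
  "Poly_Mapping.keys x \<subseteq> L \<Longrightarrow> Poly_Mapping.keys y \<subseteq> L \<Longrightarrow> Poly_Mapping.keys (x + y) \<subseteq> L"
  using Poly_Mapping.keys_add[of x y] by blast

lemma keys_relator: "w \<in> fst T \<Longrightarrow> Poly_Mapping.keys (relator w) \<subseteq> labels T"
  unfolding relator_def using coord_in_labels[of w T]
  by (intro keys_diff_subset keys_add_subset) auto

lemma subgroup_N: "subgroup (N_subgroup T) (F_group T)"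
  unfolding N_subgroup_relator
proof (rule group.generate_is_subgroup[OF group_F_group])
  show "relator ` fst T \<subseteq> carrier (F_group T)"
    using keys_relator by (intro image_subsetI) simp
qed

lemma N_keys: "n \<in> N_subgroup T \<Longrightarrow> Poly_Mapping.keys n \<subseteq> labels T"
  using subgroup.mem_carrier[OF subgroup_N] by simp

lemma relator_in_N: "w \<in> fst T \<Longrightarrow> relator w \<in> N_subgroup T"
  unfolding N_subgroup_relator by (intro generate.incl) auto

lemma N_0: "0 \<in> N_subgroup T"
  using subgroup.one_closed[OF subgroup_N[of T]] by simp

lemma N_add: "m \<in> N_subgroup T \<Longrightarrow> n \<in> N_subgroup T \<Longrightarrow> m + n \<in> N_subgroup T"
  using subgroup.m_closed[OF subgroup_N[of T]] by simp

lemma F_group_inv: "Poly_Mapping.keys x \<subseteq> labels T \<Longrightarrow> inv\<^bsub>F_group T\<^esub> x = - x"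
  by (simp add: F_group_labels)

lemma N_minus: "n \<in> N_subgroup T \<Longrightarrow> - n \<in> N_subgroup T"
  using subgroup.m_inv_closed[OF subgroup_N[of T]] F_group_inv N_keys by metis

lemma N_frag_cmul:
  assumes "n \<in> N_subgroup T" shows "frag_cmul c n \<in> N_subgroup T"
proof -
  have "n [^]\<^bsub>F_group T\<^esub> c \<in> N_subgroup T"
    by (rule group.subgroup_int_pow_closed[OF group_F_group subgroup_N assms])
  then show ?thesis using N_keys[OF assms] by (simp add: F_group_labels)
qed

text \<open>\<open>S\<close> stands for an additive subgroup of the rationals: the integers or
  \<open>{0}\<close> below.\<close>

lemma frag_eval_N:
  assumes gen: "\<And>w. w \<in> fst T \<Longrightarrow> frag_eval f (relator w) \<in> S"
    and S: "0 \<in> S" "\<And>x y. x \<in> S \<Longrightarrow> y \<in> S \<Longrightarrow> x + y \<in> S" "\<And>x. x \<in> S \<Longrightarrow> - x \<in> S"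
    and n: "n \<in> N_subgroup T"
  shows "frag_eval f n \<in> S"
  using n unfolding N_subgroup_relator
proof (induction rule: generate.induct)
  case one
  then show ?case using S by simp
next
  case (incl h)
  then show ?case using gen by auto
next
  case (inv h)
  then obtain w where w: "w \<in> fst T" "h = relator w" by blast
  then show ?case using S(3)[OF gen[OF w(1)]] by (simp add: F_group_inv[OF keys_relator])
next
  case (eng h1 h2)
  then show ?case using S by simp
qed

abbreviation N_coset :: "'a triple set \<times> 'a triple set \<Rightarrow> ('a \<Rightarrow>\<^sub>0 int) \<Rightarrow> ('a \<Rightarrow>\<^sub>0 int) set" where
  "N_coset T n \<equiv> N_subgroup T #>\<^bsub>F_group T\<^esub> n"

lemma coset_eq_iff:
  assumes "Poly_Mapping.keys x \<subseteq> labels T" "Poly_Mapping.keys y \<subseteq> labels T"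
  shows "N_coset T x = N_coset T y \<longleftrightarrow> x - y \<in> N_subgroup T"
proof -
  interpret F: comm_group "F_group T" by (rule comm_group_F_group)
  have "x \<in> N_coset T y \<longleftrightarrow> x - y \<in> N_subgroup T"
    using subgroup.rcos_module[OF subgroup_N F.is_group, of y x] assms by (simp add: F_group_inv)
  then show ?thesis
    using F.repr_independence[OF _ _ subgroup_N, of x y] F.rcos_self[OF _ subgroup_N, of x] assms by auto
qed

lemma G_group_simps:
  assumes "Poly_Mapping.keys x \<subseteq> labels T" "Poly_Mapping.keys y \<subseteq> labels T"
  shows "N_coset T x \<in> carrier (G_group T)"
    and "(N_coset T x) \<otimes>\<^bsub>G_group T\<^esub> (N_coset T y) =
      N_coset T (x + y)"
    and "inv\<^bsub>G_group T\<^esub> (N_coset T x) = N_coset T (- x)"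
proof -
  interpret F: comm_group "F_group T" by (rule comm_group_F_group)
  interpret N: normal "N_subgroup T" "F_group T"
    by (rule F.subgroup_imp_normal[OF subgroup_N])
  show c: "N_coset T x \<in> carrier (G_group T)"
    using hom_in_carrier[OF N.r_coset_hom_Mod] assms(1) by (simp add: G_group_def)
  show "(N_coset T x) \<otimes>\<^bsub>G_group T\<^esub> (N_coset T y) =
      N_coset T (x + y)"
    using hom_mult[OF N.r_coset_hom_Mod, of x y] assms by (simp add: G_group_def)
  show "inv\<^bsub>G_group T\<^esub> (N_coset T x) = N_coset T (- x)"
    using N.inv_FactGroup[of "N_coset T x"] c N.rcos_inv[of x] assms(1)
    by (simp add: G_group_def F_group_inv)
qed

lemma comm_group_G_group: "comm_group (G_group T)"
  unfolding G_group_def by (rule comm_group.abelian_FactGroup[OF comm_group_F_group subgroup_N])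

section \<open>Passing between signed weights and functionals\<close>

text \<open>Glues three weights into one function and undoes the sign flip on symbols, so that its
  value on a relator is \<open>trisum X\<close>. For a bitrade the order of the tests is harmless,
  the kinds being disjoint.\<close>

definition label_fun :: "'a triple set \<Rightarrow> (nat \<Rightarrow> 'a \<Rightarrow> rat) \<Rightarrow> 'a \<Rightarrow> rat" where
  "label_fun P X l = (if l \<in> coord 3 ` P then - X 3 l else if l \<in> coord 2 ` P then X 2 l else X 1 l)"

definition label_sign :: "nat \<Rightarrow> rat" where
  "label_sign i = (if i = 3 then -1 else 1)"

lemma label_sign_square [simp]: "label_sign i * label_sign i = 1"
  by (simp add: label_sign_def)

lemma label_fun_coord:
  assumes T: "latin_bitrade T" and w: "w \<in> fst T" and i: "i \<in> {1,2,3}"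
  shows "label_fun (fst T) X (coord i w) = label_sign i * X i (coord i w)"
proof -
  have ne: "coord i w \<notin> coord j ` fst T" if "j \<in> {1,2,3}" "j \<noteq> i" for j
    using latin_bitrade_labels_disjoint[OF T i that(1)] that(2) w by blast
  have mem: "coord i w \<in> coord i ` fst T" using w by blast
  from i consider "i = 1" | "i = 2" | "i = 3" by blast
  then show ?thesis
  proof cases
    case 1
    then show ?thesis using ne[of 2] ne[of 3] by (simp add: label_fun_def label_sign_def)
  next
    case 2
    then show ?thesis using ne[of 3] mem by (simp add: label_fun_def label_sign_def)
  next
    case 3
    then show ?thesis using mem by (simp add: label_fun_def label_sign_def)
  qed
qed

lemma frag_eval_relator_label_fun:
  assumes "latin_bitrade T" "w \<in> fst T"
  shows "frag_eval (label_fun (fst T) X) (relator w) = trisum X w"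
  using label_fun_coord[OF assms, of 1 X] label_fun_coord[OF assms, of 2 X]
    label_fun_coord[OF assms, of 3 X]
  by (simp add: relator_def trisum_def label_sign_def)

text \<open>The converse passage: any functional becomes a signed weight, to which the results on
  \<open>trisum\<close> apply.\<close>

lemma frag_eval_relator_trisum:
  "frag_eval f (relator w) = trisum (\<lambda>i l. label_sign i * f l) w"
  by (simp add: relator_def trisum_def label_sign_def)

section \<open>Labels of one kind stay distinct modulo N(T)\<close>

lemma label_difference_notin_N:
  assumes T: "latin_bitrade T" "spherical T" and i: "i \<in> {1,2,3}"
    and w: "wu \<in> fst T" "wv \<in> fst T" and ne: "coord i wu \<noteq> coord i wv"
  shows "frag_of (coord i wu) - frag_of (coord i wv) \<notin> N_subgroup T"
proof
  let ?u = "coord i wu" and ?v = "coord i wv" and ?s = "label_sign i"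
  assume N: "frag_of ?u - frag_of ?v \<in> N_subgroup T"
  have ind: "indecomposable T" using T(2) unfolding spherical_def by blast
  obtain j k where ijk: "{i,j,k} = {1,2,3}" using other_indices[OF i] .
  note fin = latin_bitrade_finite(1)[OF T(1)] and I = three_indices[OF ijk]
  obtain X where X: "\<And>w0. w0 \<in> fst T \<Longrightarrow> \<forall>w\<in>fst T. trisum (X w0) w = of_bool (w = w0)"
    using dual_solution_exists[OF T] by metis
  define Y where "Y w0 = label_fun (fst T) (X w0)" for w0
  have Yrel: "frag_eval (Y w0) (relator w) = of_bool (w = w0)" if "w0 \<in> fst T" "w \<in> fst T" for w0 w
    unfolding Y_def using frag_eval_relator_label_fun[OF T(1) that(2)] X[OF that(1)] that(2) by simp
  have Ycoord: "Y w0 (coord i w) = ?s * X w0 i (coord i w)" if "w \<in> fst T" for w0 w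
    unfolding Y_def by (rule label_fun_coord[OF T(1) that i])
  define A where "A = {w \<in> fst T. coord i w = ?u}"
  \<comment> \<open>\<open>Y w0\<close> is 0 or 1 on relators, hence integral on N(T). The maximum
    principle puts the difference of the \<open>X w0\<close> values in [0,1), which leaves only
    0.\<close>
  have zero: "Y w0 ?u - Y w0 ?v = 0" if "w0 \<in> A" for w0
  proof -
    have w0: "w0 \<in> fst T" "coord i w0 = ?u" using that by (auto simp: A_def)
    have "frag_eval (Y w0) (frag_of ?u - frag_of ?v) \<in> \<int>"
      by (rule frag_eval_N[OF _ _ _ _ N]) (use Yrel w0 in auto)
    then have int: "X w0 i ?u - X w0 i ?v \<in> \<int>"
      using Ycoord[OF w(1)] Ycoord[OF w(2)] by (auto simp: label_sign_def dest: Ints_minus split: if_splits)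
    have "X w0 i ?v \<le> X w0 i ?u" "X w0 i ?v > X w0 i ?u - 1"
      using dual_solution_max[OF T(1) ind w0(1) X[OF w0(1)] i w(2)]
        dual_solution_gt[OF T(1) ind w0(1) X[OF w0(1)] i w(2)] w0(2) by auto
    moreover obtain z :: int where z: "X w0 i ?u - X w0 i ?v = of_int z" using int by (rule Ints_cases)
    ultimately have "(0::rat) \<le> of_int z" "of_int z < (1::rat)" by linarith+
    then have "X w0 i ?u - X w0 i ?v = 0" unfolding z by simp
    then show ?thesis using Ycoord[OF w(1)] Ycoord[OF w(2)] by simp
  qed
  \<comment> \<open>The signed indicator of \<open>?u\<close> and the sum of \<open>Y w\<close> over
    \<open>A\<close> agree on every relator: both are 1 if the triple contains \<open>?u\<close> and
    0 otherwise. So \<open>?f\<close> vanishes on N(T), and evaluating it at u - v equates a sign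
    with a sum of zeros.\<close>
  let ?f = "\<lambda>l. ?s * of_bool (l = ?u) - (\<Sum>w\<in>A. 1 * Y w l)"
  have "frag_eval ?f (frag_of ?u - frag_of ?v) \<in> {0}"
  proof (rule frag_eval_N[OF _ _ _ _ N])
    fix w assume w: "w \<in> fst T"
    have "frag_eval (\<lambda>l. \<Sum>w\<in>A. 1 * Y w l) (relator w) = (\<Sum>w0\<in>A. of_bool (w = w0))"
      unfolding frag_eval_fun_sum using Yrel w by (intro sum.cong) (auto simp: A_def)
    also have "\<dots> = of_bool (coord i w = ?u)"
      using w fin by (simp add: A_def)
    finally have 1: "frag_eval (\<lambda>l. \<Sum>w\<in>A. 1 * Y w l) (relator w) = of_bool (coord i w = ?u)" .
    have dis: "coord j w \<noteq> ?u" if "j \<in> {1,2,3}" "j \<noteq> i" for j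
      using latin_bitrade_labels_disjoint[OF T(1) i that(1)] that(2) w \<open>wu \<in> fst T\<close> by blast
    have "frag_eval (\<lambda>l. ?s * of_bool (l = ?u)) (relator w) = of_bool (coord i w = ?u)"
      unfolding frag_eval_relator_trisum trisum_indices[OF ijk]
      using dis[OF I(2)] dis[OF I(3)] I(4,5) by (simp add: mult.assoc[symmetric])
    then show "frag_eval ?f (relator w) \<in> {0}"
      unfolding frag_eval_fun_diff using 1 by simp
  qed auto
  then have "?s = (\<Sum>w\<in>A. Y w ?u - Y w ?v)"
    using ne by (simp add: sum_subtractf)
  also have "\<dots> = 0" using zero by (intro sum.neutral) auto
  finally show False by (simp add: label_sign_def split: if_splits)
qed

section \<open>Finiteness of H(T)\<close>

lemma common_denominator:
  fixes S :: "rat set"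
  assumes "finite S"
  shows "\<exists>D::int. D > 0 \<and> (\<forall>x\<in>S. of_int D * x \<in> \<int>)"
  using assms
proof induction
  case empty
  show ?case by (intro exI[of _ 1]) auto
next
  case (insert x S)
  then obtain D :: int where D: "D > 0" "\<forall>x\<in>S. of_int D * x \<in> \<int>" by blast
  obtain a b :: int where ab: "x = of_int a / of_int b" "b > 0"
    by (metis quotient_of_div quotient_of_denom_pos surj_pair)
  have "of_int (D * b) * y \<in> \<int>" if "y \<in> insert x S" for y
  proof (cases "y = x")
    case True
    then have "of_int (D * b) * y = of_int (D * a)" using ab by simp
    then show ?thesis by (metis Ints_of_int)
  next
    case False
    then have "of_int D * y \<in> \<int>" using D that by blast
    then have "of_int b * (of_int D * y) \<in> \<int>" by (rule Ints_mult[OF Ints_of_int])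
    then show ?thesis by (simp add: ac_simps)
  qed
  then show ?case using D ab by (intro exI[of _ "D * b"]) auto
qed

text \<open>The \<open>Y w\<close> are dual to the relators, and the assumption \<open>n\<close>
  places the element \<open>n\<close> in the rational span of the relators, phrased through
  annihilators. The functional \<open>f\<close> minus its expansion kills every relator, hence
  \<open>n\<close>.\<close>

lemma frag_eval_dual_expansion:
  assumes T: "finite (fst T)"
    and Y: "\<And>w w'. w \<in> fst T \<Longrightarrow> w' \<in> fst T \<Longrightarrow> frag_eval (Y w) (relator w') = of_bool (w' = w)"
    and n: "\<And>f. (\<And>w. w \<in> fst T \<Longrightarrow> frag_eval f (relator w) = 0) \<Longrightarrow> frag_eval f n = 0"
  shows "frag_eval f n = (\<Sum>w\<in>fst T. frag_eval f (relator w) * frag_eval (Y w) n)"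
proof -
  let ?g = "\<lambda>l. \<Sum>w\<in>fst T. frag_eval f (relator w) * Y w l"
  have "frag_eval (\<lambda>l. f l - ?g l) n = 0"
  proof (rule n)
    fix w assume w: "w \<in> fst T"
    have "frag_eval ?g (relator w) = (\<Sum>w0\<in>fst T. frag_eval f (relator w0) * of_bool (w = w0))"
      unfolding frag_eval_fun_sum using Y w by (intro sum.cong) auto
    also have "\<dots> = (\<Sum>w0\<in>{w}. frag_eval f (relator w0) * of_bool (w = w0))"
      using T w by (intro sum.mono_neutral_right) auto
    finally show "frag_eval (\<lambda>l. f l - ?g l) (relator w) = 0"
      unfolding frag_eval_fun_diff by simp
  qed
  then show ?thesis unfolding frag_eval_fun_diff frag_eval_fun_sum by simp
qed

text \<open>Expanding the coefficient functionals writes \<open>n\<close> as a combination of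
  relators with coefficients \<open>frag_eval (Y w) n\<close>, which are integers.\<close>

lemma in_N_if_dual_integral:
  assumes T: "finite (fst T)"
    and Y: "\<And>w w'. w \<in> fst T \<Longrightarrow> w' \<in> fst T \<Longrightarrow> frag_eval (Y w) (relator w') = of_bool (w' = w)"
    and n: "\<And>f. (\<And>w. w \<in> fst T \<Longrightarrow> frag_eval f (relator w) = 0) \<Longrightarrow> frag_eval f n = 0"
    and int: "\<And>w. w \<in> fst T \<Longrightarrow> frag_eval (Y w) n \<in> \<int>"
  shows "n \<in> N_subgroup T"
proof -
  have "\<forall>w\<in>fst T. \<exists>k. frag_eval (Y w) n = of_int k" using int by (meson Ints_cases)
  then obtain k where k: "\<And>w. w \<in> fst T \<Longrightarrow> frag_eval (Y w) n = of_int (k w)" by metis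
  have lk: "Poly_Mapping.lookup (\<Sum>w\<in>A. frag_cmul (k w) (relator w)) l =
      (\<Sum>w\<in>A. k w * Poly_Mapping.lookup (relator w) l)" for A l
    by (induction A rule: infinite_finite_induct) (simp_all add: lookup_add)
  have "n = (\<Sum>w\<in>fst T. frag_cmul (k w) (relator w))"
  proof (rule poly_mapping_eqI)
    fix l
    have "(of_int (Poly_Mapping.lookup n l) :: rat) =
        (\<Sum>w\<in>fst T. of_int (Poly_Mapping.lookup (relator w) l) * frag_eval (Y w) n)"
      using frag_eval_dual_expansion[OF T Y n, where f = "\<lambda>x. of_bool (x = l)"]
      unfolding frag_eval_of_bool .
    also have "\<dots> = of_int (\<Sum>w\<in>fst T. k w * Poly_Mapping.lookup (relator w) l)"
      unfolding of_int_sum by (intro sum.cong refl) (simp add: k)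
    finally show "Poly_Mapping.lookup n l = Poly_Mapping.lookup (\<Sum>w\<in>fst T. frag_cmul (k w) (relator w)) l"
      unfolding lk by (simp only: of_int_eq_iff)
  qed
  moreover have "(\<Sum>w\<in>A. frag_cmul (k w) (relator w)) \<in> N_subgroup T" if "A \<subseteq> fst T" for A
    using finite_subset[OF that T] that
    by (induction A rule: finite_induct) (simp_all add: N_0 N_add N_frag_cmul relator_in_N)
  ultimately show ?thesis by simp
qed

lemma g_map_difference:
  assumes "b \<in> fst T" "d \<in> fst T" "i \<in> {1,2,3}"
  shows "g_map T (coord i b) \<otimes>\<^bsub>G_group T\<^esub> inv\<^bsub>G_group T\<^esub> (g_map T (coord i d)) =
      N_coset T (frag_of (coord i b) - frag_of (coord i d))"
    and "Poly_Mapping.keys (frag_of (coord i b) - frag_of (coord i d)) \<subseteq> labels T"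
proof -
  have L: "Poly_Mapping.keys (frag_of (coord i b)) \<subseteq> labels T" "Poly_Mapping.keys (frag_of (coord i d)) \<subseteq> labels T"
    using coord_in_labels[OF assms(1,3)] coord_in_labels[OF assms(2,3)] by simp_all
  then have L': "Poly_Mapping.keys (- frag_of (coord i d)) \<subseteq> labels T" by simp
  show "g_map T (coord i b) \<otimes>\<^bsub>G_group T\<^esub> inv\<^bsub>G_group T\<^esub> (g_map T (coord i d)) =
      N_coset T (frag_of (coord i b) - frag_of (coord i d))"
    unfolding g_map_def using G_group_simps(3)[OF L(2,2)] G_group_simps(2)[OF L(1) L'] by simp
  show "Poly_Mapping.keys (frag_of (coord i b) - frag_of (coord i d)) \<subseteq> labels T"
    by (rule keys_diff_subset[OF L])
qed

text \<open>The last clause puts the representative in the rational span of the relators. A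
  functional killing all relators is constant on each kind of label, so it kills the differences
  that generate H(T); the property passes to sums and negatives.\<close>

lemma H_group_representative:
  assumes T: "latin_bitrade T" "indecomposable T" and C: "C \<in> carrier (H_group T)"
  shows "\<exists>n. Poly_Mapping.keys n \<subseteq> labels T \<and> C = N_coset T n \<and>
    (\<forall>f. (\<forall>w\<in>fst T. frag_eval f (relator w) = 0) \<longrightarrow> frag_eval f n = 0)"
proof -
  let ?R = "\<lambda>n. Poly_Mapping.keys n \<subseteq> labels T \<and>
    (\<forall>f. (\<forall>w\<in>fst T. frag_eval f (relator w) = 0) \<longrightarrow> frag_eval f n = 0)"
  let ?S = "{g_map T (coord i b) \<otimes>\<^bsub>G_group T\<^esub> inv\<^bsub>G_group T\<^esub> (g_map T (coord i d)) | i b d.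
        i \<in> {1,2,3} \<and> b \<in> fst T \<and> d \<in> fst T}"
  \<comment> \<open>The intersection comes from \<open>subgroup_generated\<close>, which cuts its
    generators down to the carrier.\<close>
  have gen: "\<exists>n. ?R n \<and> h = N_coset T n" if h: "h \<in> carrier (G_group T) \<inter> ?S" for h
  proof -
    from h obtain i b d where ibd: "i \<in> {1,2,3}" "b \<in> fst T" "d \<in> fst T"
      "h = g_map T (coord i b) \<otimes>\<^bsub>G_group T\<^esub> inv\<^bsub>G_group T\<^esub> (g_map T (coord i d))" by blast
    have "frag_eval f (frag_of (coord i b) - frag_of (coord i d)) = 0"
      if f: "\<forall>w\<in>fst T. frag_eval f (relator w) = 0" for f
    proof -
      have "label_sign i * f (coord i b) = label_sign i * f (coord i d)"
        using f unfolding frag_eval_relator_trisum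
        by (intro trisum_zero_constant[OF T ibd(1) _ ibd(2,3)]) blast
      then show ?thesis by (simp add: label_sign_def split: if_splits)
    qed
    then show ?thesis using g_map_difference[OF ibd(2,3,1)] ibd(4) by blast
  qed
  have "C \<in> generate (G_group T) (carrier (G_group T) \<inter> ?S)"
    using C unfolding H_group_def carrier_subgroup_generated .
  then have "\<exists>n. ?R n \<and> C = N_coset T n"
  proof (induction rule: generate.induct)
    case one
    have "\<one>\<^bsub>G_group T\<^esub> = N_coset T 0"
    proof -
      have "N_coset T 0 = N_subgroup T"
        using group.coset_join2[OF group_F_group _ subgroup_N N_0] by simp
      then show ?thesis by (simp add: G_group_def)
    qed
    then show ?case by (intro exI[of _ 0]) simp
  next
    case (incl h)
    then show ?case by (rule gen)
  next
    case (inv h)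
    from gen[OF inv] obtain n where n: "?R n" "h = N_coset T n" by blast
    then have "inv\<^bsub>G_group T\<^esub> h = N_coset T (- n)" using G_group_simps(3)[of n T n] by blast
    then show ?case using n(1) by (intro exI[of _ "- n"]) simp
  next
    case (eng h1 h2)
    from eng.IH obtain m n where mn: "?R m" "h1 = N_coset T m" "?R n" "h2 = N_coset T n" by blast
    then have "h1 \<otimes>\<^bsub>G_group T\<^esub> h2 = N_coset T (m + n)" using G_group_simps(2)[of m T n] by blast
    then show ?case using mn(1,3) by (intro exI[of _ "m + n"]) (simp add: keys_add_subset)
  qed
  then show ?thesis by blast
qed

text \<open>Let \<open>D\<close> be a common denominator of all values \<open>Y w l\<close>.
  Representatives congruent modulo \<open>D\<close> in every coefficient differ by an element on
  which each \<open>Y w\<close> is integral, hence by an element of N(T). So the residues determine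
  the coset.\<close>

lemma finite_H_group:
  assumes T: "latin_bitrade T" "spherical T"
  shows "finite (carrier (H_group T))"
proof -
  have ind: "indecomposable T" using T(2) unfolding spherical_def by blast
  note fin = latin_bitrade_finite(1)[OF T(1)] and finL = finite_labels[OF T(1)]
  obtain X where X: "\<And>w0. w0 \<in> fst T \<Longrightarrow> \<forall>w\<in>fst T. trisum (X w0) w = of_bool (w = w0)"
    using dual_solution_exists[OF T] by metis
  define Y where "Y w0 = label_fun (fst T) (X w0)" for w0
  have Y: "frag_eval (Y w0) (relator w) = of_bool (w = w0)" if "w0 \<in> fst T" "w \<in> fst T" for w0 w
    unfolding Y_def using frag_eval_relator_label_fun[OF T(1) that(2)] X[OF that(1)] that(2) by simp
  have "finite ((\<lambda>(w, l). Y w l) ` (fst T \<times> labels T))" using fin finL by blast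
  from common_denominator[OF this] obtain D :: int where D: "D > 0"
    "\<And>w l. w \<in> fst T \<Longrightarrow> l \<in> labels T \<Longrightarrow> of_int D * Y w l \<in> \<int>" by auto
  obtain rep where rep: "\<And>C. C \<in> carrier (H_group T) \<Longrightarrow> Poly_Mapping.keys (rep C) \<subseteq> labels T"
    "\<And>C. C \<in> carrier (H_group T) \<Longrightarrow> C = N_coset T (rep C)"
    "\<And>C f. C \<in> carrier (H_group T) \<Longrightarrow> \<forall>w\<in>fst T. frag_eval f (relator w) = 0 \<Longrightarrow> frag_eval f (rep C) = 0"
    using H_group_representative[OF T(1) ind] by metis
  \<comment> \<open>Since \<open>rep\<close> is an arbitrary choice, \<phi> serves only as an
    injection of sets; \<open>restrict\<close> puts its values in a finite extensional function
    space.\<close>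
  define \<phi> where "\<phi> C = restrict (\<lambda>l. Poly_Mapping.lookup (rep C) l mod D) (labels T)" for C
  have "inj_on \<phi> (carrier (H_group T))"
  proof (rule inj_onI)
    fix C C' assume C: "C \<in> carrier (H_group T)" "C' \<in> carrier (H_group T)" and eq: "\<phi> C = \<phi> C'"
    let ?n = "rep C - rep C'"
    have keys: "Poly_Mapping.keys ?n \<subseteq> labels T" using rep(1) C by (intro keys_diff_subset)
    have "?n \<in> N_subgroup T"
    proof (rule in_N_if_dual_integral[OF fin Y])
      fix f assume "\<And>w. w \<in> fst T \<Longrightarrow> frag_eval f (relator w) = 0"
      then show "frag_eval f ?n = 0" using rep(3)[OF C(1), of f] rep(3)[OF C(2), of f] by simp
    next
      fix w assume w: "w \<in> fst T"
      have "of_int (Poly_Mapping.lookup ?n l) * Y w l \<in> \<int>" if l: "l \<in> labels T" for l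
      proof -
        have "Poly_Mapping.lookup (rep C) l mod D = Poly_Mapping.lookup (rep C') l mod D"
          using fun_cong[OF eq, of l] l by (simp add: \<phi>_def)
        then have "D dvd Poly_Mapping.lookup ?n l"
          by (simp add: lookup_minus mod_eq_dvd_iff)
        then obtain c where "Poly_Mapping.lookup ?n l = D * c" by (rule dvdE)
        then have "of_int (Poly_Mapping.lookup ?n l) * Y w l = of_int c * (of_int D * Y w l)" by simp
        then show ?thesis using D(2)[OF w l] by (metis Ints_mult Ints_of_int)
      qed
      then show "frag_eval (Y w) ?n \<in> \<int>"
        unfolding frag_eval_superset[OF finL keys] by (rule Ints_sum)
    qed
    then show "C = C'"
      using coset_eq_iff[OF rep(1)[OF C(1)] rep(1)[OF C(2)]] rep(2) C by blast
  qed
  moreover have "\<phi> ` carrier (H_group T) \<subseteq> labels T \<rightarrow>\<^sub>E {0..<D}"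
    using D(1) by (auto simp: \<phi>_def)
  ultimately show ?thesis
    using finL by (meson finite_PiE finite_atLeastLessThan_int finite_imageD finite_subset)
qed

section \<open>The embedding into H(T)\<close>

theorem theorem5p7:
  fixes T :: "'a triple set \<times> 'a triple set"
  assumes "latin_bitrade T" and "spherical T"
  shows "(\<exists>\<sigma>. embedding (fst T) (H_group T) \<sigma>) \<and> finite (carrier (H_group T))"
proof
  show "finite (carrier (H_group T))" by (rule finite_H_group[OF assms])
  \<comment> \<open>For an empty mate the equation m = s + 2 would read 0 = 2.\<close>
  have "fst T \<noteq> {}"
    using assms(2) unfolding spherical_def by auto
  then obtain a where a: "a \<in> fst T" by blast
  \<comment> \<open>Subtracting the labels of a fixed triple \<open>a\<close> moves the values into
    H(T). The subtracted labels combine to the relator of \<open>a\<close>, so the homotopy equation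
    survives, and they cancel in the test of injectivity.\<close>
  let ?d = "\<lambda>i x. frag_of x - frag_of (coord i a)"
  define \<sigma> where "\<sigma> = (\<lambda>i x. N_coset T (?d i x))"
  have keys: "Poly_Mapping.keys (?d i (coord i w)) \<subseteq> labels T" if "w \<in> fst T" "i \<in> {1,2,3}" for i w
    by (rule g_map_difference(2)[OF that(1) a that(2)])
  have "homotopy (fst T) (H_group T) \<sigma>"
    unfolding homotopy_def
  proof (intro conjI ballI)
    show "comm_group (H_group T)"
      unfolding H_group_def
      by (rule group.abelian_subgroup_generated[OF comm_group.axioms(2)[OF comm_group_G_group] comm_group_G_group])
  next
    fix i :: nat assume i: "i \<in> {1,2,3}"
    have "\<sigma> i (coord i w) \<in> carrier (H_group T)" if w: "w \<in> fst T" for w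
      unfolding H_group_def carrier_subgroup_generated
    proof (rule generate.incl, rule IntI)
      show "\<sigma> i (coord i w) \<in> carrier (G_group T)"
        unfolding \<sigma>_def by (rule G_group_simps(1)[OF keys[OF w i] keys[OF w i]])
      show "\<sigma> i (coord i w) \<in> {g_map T (coord i b) \<otimes>\<^bsub>G_group T\<^esub> inv\<^bsub>G_group T\<^esub> (g_map T (coord i d)) | i b d.
          i \<in> {1,2,3} \<and> b \<in> fst T \<and> d \<in> fst T}"
        unfolding \<sigma>_def g_map_difference(1)[OF w a i, symmetric] using w a i by blast
    qed
    then show "\<sigma> i \<in> coord i ` fst T \<rightarrow> carrier (H_group T)" by blast
  next
    fix w assume w: "w \<in> fst T"
    have "(?d 1 (coord 1 w) + ?d 2 (coord 2 w)) - ?d 3 (coord 3 w) = relator w + - relator a"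
      by (simp add: relator_def)
    then have "(?d 1 (coord 1 w) + ?d 2 (coord 2 w)) - ?d 3 (coord 3 w) \<in> N_subgroup T"
      using N_add[OF relator_in_N[OF w] N_minus[OF relator_in_N[OF a]]] by simp
    moreover note k = keys[OF w, of 1] keys[OF w, of 2] keys[OF w, of 3]
    ultimately have "N_coset T (?d 1 (coord 1 w) + ?d 2 (coord 2 w)) = N_coset T (?d 3 (coord 3 w))"
      by (subst coset_eq_iff) (auto intro: keys_add_subset[THEN subsetD])
    then have "\<sigma> 1 (coord 1 w) \<otimes>\<^bsub>H_group T\<^esub> \<sigma> 2 (coord 2 w) = \<sigma> 3 (coord 3 w)"
      unfolding \<sigma>_def H_group_def mult_subgroup_generated
      using G_group_simps(2)[OF k(1,2)] by simp
    then show "case w of (u1, u2, u3) \<Rightarrow> \<sigma> 1 u1 \<otimes>\<^bsub>H_group T\<^esub> \<sigma> 2 u2 = \<sigma> 3 u3"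
      by (cases w) (simp add: coord_def)
  qed
  moreover have "inj_on (\<sigma> i) (coord i ` fst T)" if i: "i \<in> {1,2,3}" for i
  proof (rule inj_onI, elim imageE, simp only:)
    fix w w' assume w: "w \<in> fst T" "w' \<in> fst T" and eq: "\<sigma> i (coord i w) = \<sigma> i (coord i w')"
    have "?d i (coord i w) - ?d i (coord i w') \<in> N_subgroup T"
      using eq coset_eq_iff[OF keys[OF w(1) i] keys[OF w(2) i]] unfolding \<sigma>_def by simp
    then show "coord i w = coord i w'"
      using label_difference_notin_N[OF assms i w] by auto
  qed
  ultimately show "\<exists>\<sigma>. embedding (fst T) (H_group T) \<sigma>"
    unfolding embedding_def by blast
qed

end
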